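(* Let $(X,G)$ be a minimal topological dynamical system. Then there is a subodometer $(\overleftarrow{G},G)$ (respectively, an odometer $(\overleftarrow{G},G)$) such that $(X,G)$ is an almost 1-1 extension of $(\overleftarrow{G},G)$ by some factor map $\pi$ if and only if $(X,G)$ is a regularly recurrent system (respectively, a strongly regularly recurrent system). Moreover, for such a $\pi:X\to\overleftarrow{G}$, the set of regularly recurrent (respectively, strongly regularly recurrent) points of $X$ is exactly the pre-image under $\pi$ of the set of points of $\overleftarrow{G}$ which have only one pre-image by $\pi$.
   Context: $G$ is a discrete finitely generated group with neutral element $e$. A topological dynamical system $(X,G)$ is a compact metric space $X$ with an action of $G$ by homeomorphisms, written $g.x$. It is minimal if every $G$-orbit is dense. A factor map $\pi:(X,G)\to(Y,G)$ is a continuous surjection commuting with the actions; it is an almost 1-1 factor map, and $(X,G)$ is an almost 1-1 extension of $(Y,G)$ by $\pi$, if the set of points of $Y$ having exactly one pre-image contains a dense $G_\delta$ subset of $Y$. Subodometers: let $\Gamma_0\supseteq\Gamma_1\supseteq\cdots$ be a decreasing sequence of finite-index subgroups of $G$ (it is not required that $\bigcap_i\Gamma_i=\{e\}$), let $G/\Gamma_i=\{g\Gamma_i: g\in G\}$ with the discrete topology and $\pi_i:G/\Gamma_{i+1}\to G/\Gamma_i$ the map induced by inclusion. The inverse limit $\overleftarrow{G}=\lim_{\leftarrow i}(G/\Gamma_i,\pi_i)\subseteq\prod_i G/\Gamma_i$ with the product topology and the action of $G$ by left multiplication on each coordinate is called a subodometer; it is called an odometer if in addition every $\Gamma_i$ is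 normal in $G$. For $x\in X$ and $A\subseteq X$ let $T_A(x)=\{g\in G: g.x\in A\}$. A subgroup of $G$ is syndetic if and only if it has finite index. A point $x\in X$ is regularly recurrent if for every open neighborhood $V$ of $x$ there is a syndetic subgroup $\Gamma$ of $G$ with $\Gamma\subseteq T_V(x)$. A point $x$ is strongly regularly recurrent if for every open neighborhood $V$ of $x$ there is a clopen neighborhood $W\subseteq V$ of $x$ such that $T_W(x)$ is a syndetic normal subgroup of $G$. A system is (strongly) regularly recurrent if it is the closure of the $G$-orbit of a (strongly) regularly recurrent point. *)

theory Defs
  imports
    "HOL-Analysis.Analysis"
    "HOL-Algebra.Left_Coset"
    "HOL-Algebra.Group_Action"
    "HOL-Algebra.Generated_Groups"
begin

definition finitely_generated_group :: "('g, 'm) monoid_scheme \<Rightarrow> bool" where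
  "finitely_generated_group G \<longleftrightarrow>
     group G \<and> (\<exists>S. finite S \<and> S \<subseteq> carrier G \<and> generate G S = carrier G)"

text \<open>Since \<^const>\<open>group_action\<close> takes values in \<^const>\<open>BijGroup\<close>, each map \<open>\<phi> g\<close> is
  normalised to be \<^const>\<open>undefined\<close> outside \<open>topspace X\<close>.\<close>

definition topological_dynamical_system ::
  "('g, 'm) monoid_scheme \<Rightarrow> 'x topology \<Rightarrow> ('g \<Rightarrow> 'x \<Rightarrow> 'x) \<Rightarrow> bool" where
  "topological_dynamical_system G X \<phi> \<longleftrightarrow>
     compact_space X \<and> metrizable_space X \<and>
     group_action G (topspace X) \<phi> \<and>
     (\<forall>g\<in>carrier G. homeomorphic_map X X (\<phi> g))"

definition minimal_system ::
  "('g, 'm) monoid_scheme \<Rightarrow> 'x topology \<Rightarrow> ('g \<Rightarrow> 'x \<Rightarrow> 'x) \<Rightarrow> bool" where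
  "minimal_system G X \<phi> \<longleftrightarrow>
     topological_dynamical_system G X \<phi> \<and>
     (\<forall>x\<in>topspace X. X closure_of (orbit G \<phi> x) = topspace X)"

definition factor_map ::
  "('g, 'm) monoid_scheme \<Rightarrow> 'x topology \<Rightarrow> ('g \<Rightarrow> 'x \<Rightarrow> 'x)
    \<Rightarrow> 'y topology \<Rightarrow> ('g \<Rightarrow> 'y \<Rightarrow> 'y) \<Rightarrow> ('x \<Rightarrow> 'y) \<Rightarrow> bool" where
  "factor_map G X \<phi> Y \<psi> \<pi> \<longleftrightarrow>
     continuous_map X Y \<pi> \<and> \<pi> ` topspace X = topspace Y \<and>
     (\<forall>g\<in>carrier G. \<forall>x\<in>topspace X. \<pi> (\<phi> g x) = \<psi> g (\<pi> x))"

definition injectivity_points :: "'x topology \<Rightarrow> 'y topology \<Rightarrow> ('x \<Rightarrow> 'y) \<Rightarrow> 'y set" where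
  "injectivity_points X Y \<pi> = {y \<in> topspace Y. \<exists>!x. x \<in> topspace X \<and> \<pi> x = y}"

definition almost_one_to_one_factor_map ::
  "('g, 'm) monoid_scheme \<Rightarrow> 'x topology \<Rightarrow> ('g \<Rightarrow> 'x \<Rightarrow> 'x)
    \<Rightarrow> 'y topology \<Rightarrow> ('g \<Rightarrow> 'y \<Rightarrow> 'y) \<Rightarrow> ('x \<Rightarrow> 'y) \<Rightarrow> bool" where
  "almost_one_to_one_factor_map G X \<phi> Y \<psi> \<pi> \<longleftrightarrow>
     factor_map G X \<phi> Y \<psi> \<pi> \<and>
     (\<exists>D. gdelta_in Y D \<and> Y closure_of D = topspace Y \<and> D \<subseteq> injectivity_points X Y \<pi>)"

text \<open>For subgroups, syndetic means of finite index.\<close>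

definition syndetic_subgroup :: "('g, 'm) monoid_scheme \<Rightarrow> 'g set \<Rightarrow> bool" where
  "syndetic_subgroup G H \<longleftrightarrow> subgroup H G \<and> finite (lcosets\<^bsub>G\<^esub> H)"

definition subodometer_sequence :: "('g, 'm) monoid_scheme \<Rightarrow> (nat \<Rightarrow> 'g set) \<Rightarrow> bool" where
  "subodometer_sequence G \<Gamma> \<longleftrightarrow>
     (\<forall>i. syndetic_subgroup G (\<Gamma> i)) \<and> (\<forall>i. \<Gamma> (Suc i) \<subseteq> \<Gamma> i)"

definition odometer_sequence :: "('g, 'm) monoid_scheme \<Rightarrow> (nat \<Rightarrow> 'g set) \<Rightarrow> bool" where
  "odometer_sequence G \<Gamma> \<longleftrightarrow> subodometer_sequence G \<Gamma> \<and> (\<forall>i. \<Gamma> i \<lhd> G)"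

text \<open>The map \<open>G/H \<rightarrow> G/K\<close> induced by an inclusion \<open>H \<subseteq> K\<close>; that it sends \<open>gH\<close> to
  \<open>gHK = gK\<close> is the lemma below.\<close>

definition coset_projection :: "('g, 'm) monoid_scheme \<Rightarrow> 'g set \<Rightarrow> 'g set \<Rightarrow> 'g set" where
  "coset_projection G K C = C <#>\<^bsub>G\<^esub> K"

lemma coset_projection_l_coset:
  assumes "group G" "subgroup H G" "subgroup K G" "H \<subseteq> K" "g \<in> carrier G"
  shows "coset_projection G K (l_coset G g H) = l_coset G g K"
proof -
  interpret group G by fact
  have "set_mult G H K = K"
  proof
    show "set_mult G H K \<subseteq> K"
      using assms(3,4) by (auto simp: set_mult_def intro: subgroup.m_closed)
    have "\<one>\<^bsub>G\<^esub> \<otimes>\<^bsub>G\<^esub> k \<in> set_mult G H K" if "k \<in> K" for k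
      using that subgroup.one_closed[OF assms(2)] unfolding set_mult_def by blast
    then show "K \<subseteq> set_mult G H K"
      using subgroup.subset[OF assms(3)] by force
  qed
  then show ?thesis
    using setmult_lcos_assoc[of H K g] assms
    by (simp add: coset_projection_def subgroup.subset)
qed

definition subodometer :: "('g, 'm) monoid_scheme \<Rightarrow> (nat \<Rightarrow> 'g set) \<Rightarrow> (nat \<Rightarrow> 'g set) topology" where
  "subodometer G \<Gamma> =
     subtopology (product_topology (\<lambda>i. discrete_topology (lcosets\<^bsub>G\<^esub> (\<Gamma> i))) UNIV)
       {x. \<forall>i. coset_projection G (\<Gamma> i) (x (Suc i)) = x i}"

definition subodometer_action ::
  "('g, 'm) monoid_scheme \<Rightarrow> (nat \<Rightarrow> 'g set) \<Rightarrow> 'g \<Rightarrow> (nat \<Rightarrow> 'g set) \<Rightarrow> (nat \<Rightarrow> 'g set)" where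
  "subodometer_action G \<Gamma> g = (\<lambda>x\<in>topspace (subodometer G \<Gamma>). (\<lambda>i. l_coset G g (x i)))"

definition return_times ::
  "('g, 'm) monoid_scheme \<Rightarrow> ('g \<Rightarrow> 'x \<Rightarrow> 'x) \<Rightarrow> 'x set \<Rightarrow> 'x \<Rightarrow> 'g set" where
  "return_times G \<phi> A x = {g \<in> carrier G. \<phi> g x \<in> A}"

definition regularly_recurrent_point ::
  "('g, 'm) monoid_scheme \<Rightarrow> 'x topology \<Rightarrow> ('g \<Rightarrow> 'x \<Rightarrow> 'x) \<Rightarrow> 'x \<Rightarrow> bool" where
  "regularly_recurrent_point G X \<phi> x \<longleftrightarrow>
     x \<in> topspace X \<and>
     (\<forall>V. openin X V \<and> x \<in> V \<longrightarrow>
        (\<exists>H. syndetic_subgroup G H \<and> H \<subseteq> return_times G \<phi> V x))"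

definition strongly_regularly_recurrent_point ::
  "('g, 'm) monoid_scheme \<Rightarrow> 'x topology \<Rightarrow> ('g \<Rightarrow> 'x \<Rightarrow> 'x) \<Rightarrow> 'x \<Rightarrow> bool" where
  "strongly_regularly_recurrent_point G X \<phi> x \<longleftrightarrow>
     x \<in> topspace X \<and>
     (\<forall>V. openin X V \<and> x \<in> V \<longrightarrow>
        (\<exists>W. openin X W \<and> closedin X W \<and> x \<in> W \<and> W \<subseteq> V \<and>
             syndetic_subgroup G (return_times G \<phi> W x) \<and> return_times G \<phi> W x \<lhd> G))"

definition regularly_recurrent_system ::
  "('g, 'm) monoid_scheme \<Rightarrow> 'x topology \<Rightarrow> ('g \<Rightarrow> 'x \<Rightarrow> 'x) \<Rightarrow> bool" where
  "regularly_recurrent_system G X \<phi> \<longleftrightarrow>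
     (\<exists>x. regularly_recurrent_point G X \<phi> x \<and> X closure_of (orbit G \<phi> x) = topspace X)"

definition strongly_regularly_recurrent_system ::
  "('g, 'm) monoid_scheme \<Rightarrow> 'x topology \<Rightarrow> ('g \<Rightarrow> 'x \<Rightarrow> 'x) \<Rightarrow> bool" where
  "strongly_regularly_recurrent_system G X \<phi> \<longleftrightarrow>
     (\<exists>x. strongly_regularly_recurrent_point G X \<phi> x \<and>
          X closure_of (orbit G \<phi> x) = topspace X)"

end

theory Submission
  imports Defs
begin

text \<open>If \<open>x\<close> is regularly recurrent, the orbit closures of a finite-index normal subgroup \<open>N\<close>
  partition \<open>X\<close> into finitely many clopen pieces, so \<open>x\<close> has arbitrarily small clopen
  neighbourhoods \<open>W\<close> whose return set \<open>\<Gamma> = T\<^sub>W(x)\<close> is a finite-index subgroup. The translates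
  \<open>gW\<close> are then indexed by \<open>G/\<Gamma>\<close> and partition \<open>X\<close>, so \<open>z \<mapsto> {g. g\<inverse>z \<in> W}\<close> is a locally constant
  equivariant map \<open>X \<rightarrow> G/\<Gamma>\<close>. A decreasing sequence of such \<open>W\<close> shrinking to \<open>x\<close> gives a factor
  map to a subodometer that is injective over the orbit of \<open>x\<close>. Conversely, the fibre over an injectivity
  point is approximated by preimages of cylinders, whose return sets are coset stabilisers.\<close>

section \<open>Finite-index subgroups\<close>

text \<open>The multiset relation \<open><#\<close> makes nested left cosets ambiguous.\<close>

no_notation subset_mset (infix \<open><#\<close> 50)

context group
begin

lemma mem_l_coset_iff:
  assumes "subgroup H G" "a \<in> carrier G"
  shows "g \<in> a <# H \<longleftrightarrow> g \<in> carrier G \<and> inv a \<otimes> g \<in> H"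
  using assms subgroup.lcos_module_imp[OF assms(1) is_group] subgroup.lcos_module_rev[OF assms(1) is_group]
    subgroup.elemlcos_carrier[OF assms(1) is_group]
  by blast

lemma l_coset_eq_iff:
  assumes "subgroup H G" "a \<in> carrier G" "b \<in> carrier G"
  shows "a <# H = b <# H \<longleftrightarrow> inv a \<otimes> b \<in> H"
  using assms lcos_self l_repr_independence mem_l_coset_iff by metis

lemma mem_lcosets_iff: "C \<in> lcosets H \<longleftrightarrow> (\<exists>a\<in>carrier G. C = a <# H)"
  by (auto simp: LCOSETS_def)

text \<open>The coset projection sends \<open>lcosets H\<close> onto \<open>lcosets K\<close>, so
  finiteness passes to the larger subgroup.\<close>

lemma syndetic_subgroup_mono:
  assumes H: "syndetic_subgroup G H" and K: "subgroup K G" and "H \<subseteq> K"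
  shows "syndetic_subgroup G K"
proof -
  have "subgroup H G" "finite (lcosets H)"
    using H by (auto simp: syndetic_subgroup_def)
  moreover have "lcosets K \<subseteq> coset_projection G K ` (lcosets H)"
    using coset_projection_l_coset[OF is_group \<open>subgroup H G\<close> K \<open>H \<subseteq> K\<close>]
    by (force simp: mem_lcosets_iff image_iff)
  ultimately show ?thesis
    using K by (metis finite_imageI finite_subset syndetic_subgroup_def)
qed

text \<open>This is the kernel of the left action of \<open>G\<close> on \<open>G/H\<close>,
  equivalently the intersection of all conjugates of \<open>H\<close>. In this form it visibly fixes
  every coset, which is how it later acts on the coordinates of a subodometer.\<close>

definition normal_core :: "'a set \<Rightarrow> 'a set" where
  "normal_core H = {g \<in> carrier G. \<forall>a\<in>carrier G. g <# (a <# H) = a <# H}"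

lemma mem_normal_core_iff:
  assumes "subgroup H G"
  shows "g \<in> normal_core H \<longleftrightarrow> g \<in> carrier G \<and> (\<forall>a\<in>carrier G. inv a \<otimes> g \<otimes> a \<in> H)"
proof -
  have "g <# (a <# H) = a <# H \<longleftrightarrow> inv a \<otimes> g \<otimes> a \<in> H" if "g \<in> carrier G" "a \<in> carrier G" for a
  proof -
    have "g <# (a <# H) = (g \<otimes> a) <# H"
      using that assms by (simp add: lcos_m_assoc subgroup.subset)
    then show ?thesis
      using l_coset_eq_iff[OF assms, of a "g \<otimes> a"] that by (auto simp: m_assoc)
  qed
  then show ?thesis
    by (auto simp: normal_core_def)
qed

lemma normal_core_subset:
  assumes "subgroup H G"
  shows "normal_core H \<subseteq> H"
  using mem_normal_core_iff[OF assms] by fastforce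

lemma normal_normal_core:
  assumes H: "subgroup H G"
  shows "normal_core H \<lhd> G"
proof -
  interpret H: subgroup H G by fact
  note mem = mem_normal_core_iff[OF H]
  have "subgroup (normal_core H) G"
  proof (rule subgroupI)
    show "normal_core H \<subseteq> carrier G" by (auto simp: mem)
    show "normal_core H \<noteq> {}" using mem[of \<one>] by force
    fix g assume g: "g \<in> normal_core H"
    have "inv a \<otimes> inv g \<otimes> a = inv (inv a \<otimes> g \<otimes> a)" if "a \<in> carrier G" for a
      using g that by (simp add: mem inv_mult_group m_assoc)
    then show "inv g \<in> normal_core H" using g by (auto simp: mem)
    fix h assume h: "h \<in> normal_core H"
    have "inv a \<otimes> (g \<otimes> h) \<otimes> a = (inv a \<otimes> g \<otimes> a) \<otimes> (inv a \<otimes> h \<otimes> a)" if "a \<in> carrier G" for a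
    proof -
      have "a \<otimes> (inv a \<otimes> (h \<otimes> a)) = h \<otimes> a"
        using g h that by (simp add: mem m_assoc[symmetric])
      then show ?thesis
        using g h that by (simp add: mem m_assoc)
    qed
    then show "g \<otimes> h \<in> normal_core H" using g h by (auto simp: mem)
  qed
  moreover have "x \<otimes> h \<otimes> inv x \<in> normal_core H" if "x \<in> carrier G" "h \<in> normal_core H" for x h
  proof -
    have "inv a \<otimes> (x \<otimes> h \<otimes> inv x) \<otimes> a = inv (inv x \<otimes> a) \<otimes> h \<otimes> (inv x \<otimes> a)" if "a \<in> carrier G" for a
      using that \<open>x \<in> carrier G\<close> \<open>h \<in> normal_core H\<close> by (simp add: mem inv_mult_group m_assoc)
    then show ?thesis using that by (auto simp: mem)
  qed
  ultimately show ?thesis by (simp add: normal_inv_iff)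
qed

text \<open>A coset of the core is determined by the permutation of \<open>G/H\<close> it induces.\<close>

lemma syndetic_normal_core:
  assumes "syndetic_subgroup G H"
  shows "syndetic_subgroup G (normal_core H)"
proof -
  have H: "subgroup H G" and fin: "finite (lcosets H)"
    using assms by (auto simp: syndetic_subgroup_def)
  let ?N = "normal_core H"
  have N: "subgroup ?N G"
    using normal_normal_core[OF H] normal_imp_subgroup by blast
  \<comment> \<open>Restriction to \<open>lcosets H\<close> makes \<open>perm g\<close> extensional,
    so that it lies in a finite function space.\<close>
  define perm where "perm g = (\<lambda>C\<in>lcosets H. g <# C)" for g
  have "perm g \<in> lcosets H \<rightarrow>\<^sub>E lcosets H" if "g \<in> carrier G" for g
  proof -
    have "g <# (a <# H) = (g \<otimes> a) <# H" if "a \<in> carrier G" for a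
      using that \<open>g \<in> carrier G\<close> H by (simp add: lcos_m_assoc subgroup.subset)
    then show ?thesis
      using that by (fastforce simp: perm_def mem_lcosets_iff)
  qed
  then have fin': "finite (perm ` carrier G)"
    by (meson fin finite_PiE finite_subset image_subsetI)
  have "g <# ?N = h <# ?N" if "g \<in> carrier G" "h \<in> carrier G" "perm g = perm h" for g h
  proof -
    have "(inv g \<otimes> h) <# (a <# H) = a <# H" if a: "a \<in> carrier G" for a
    proof -
      have sub: "a <# H \<subseteq> carrier G"
        using H a by (simp add: l_coset_subset_G subgroup.subset)
      have "a <# H \<in> lcosets H" using a by (auto simp: mem_lcosets_iff)
      then have "h <# (a <# H) = g <# (a <# H)"
        using fun_cong[OF \<open>perm g = perm h\<close>, of "a <# H"] by (simp add: perm_def)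
      then have "(inv g \<otimes> h) <# (a <# H) = inv g <# (g <# (a <# H))"
        using lcos_m_assoc[OF sub, of "inv g" h] \<open>g \<in> carrier G\<close> \<open>h \<in> carrier G\<close> by simp
      also have "\<dots> = a <# H"
        using sub \<open>g \<in> carrier G\<close> by (simp add: lcos_m_assoc lcos_mult_one)
      finally show ?thesis .
    qed
    then show ?thesis
      using that l_coset_eq_iff[OF N, of g h] by (simp add: normal_core_def)
  qed
  then have "a <# ?N = (SOME g. g \<in> carrier G \<and> perm g = perm a) <# ?N" if "a \<in> carrier G" for a
    using someI[of "\<lambda>g. g \<in> carrier G \<and> perm g = perm a" a] that by metis
  \<comment> \<open>\<open>SOME\<close> selects one representative for each permutation that occurs,
    which covers the cosets of the core by the image of a finite set.\<close>
  then have "lcosets ?N \<subseteq> (\<lambda>p. (SOME g. g \<in> carrier G \<and> perm g = p) <# ?N) ` perm ` carrier G"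
    by (auto simp: LCOSETS_def)
  with fin' N show ?thesis
    by (meson finite_imageI finite_subset syndetic_subgroup_def)
qed

text \<open>Pigeonhole: among the cosets of the powers of \<open>k\<close> two coincide, and the
  difference of their exponents is the required \<open>m\<close>.\<close>

lemma pow_mem_syndetic_subgroup:
  assumes "syndetic_subgroup G H" "k \<in> carrier G"
  obtains m :: nat where "m > 0" "k [^] m \<in> H"
proof -
  have H: "subgroup H G" and fin: "finite (lcosets H)"
    using assms by (auto simp: syndetic_subgroup_def)
  have "range (\<lambda>n::nat. k [^] n <# H) \<subseteq> lcosets H"
    using assms(2) by (auto simp: LCOSETS_def)
  then have "\<not> inj (\<lambda>n::nat. k [^] n <# H)"
    using fin finite_subset finite_imageD infinite_UNIV_nat by blast
  then obtain i j :: nat where "i < j" "k [^] i <# H = k [^] j <# H"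
    by (metis linorder_injI)
  then have "inv (k [^] i) \<otimes> k [^] j \<in> H"
    using H assms by (simp add: l_coset_eq_iff)
  moreover have "k [^] j = k [^] i \<otimes> k [^] (j - i)"
    using \<open>i < j\<close> assms by (simp add: nat_pow_mult)
  ultimately have "k [^] (j - i) \<in> H"
    using assms by (simp add: m_assoc[symmetric])
  then show ?thesis using \<open>i < j\<close> that[of "j - i"] by auto
qed

text \<open>The stabiliser of a coset is a conjugate of \<open>H\<close>, hence \<open>H\<close>
  itself by normality. This will identify the return set of a cylinder in an odometer.\<close>

lemma l_coset_fix_iff_normal:
  assumes "H \<lhd> G" "a \<in> carrier G" "g \<in> carrier G"
  shows "g <# (a <# H) = a <# H \<longleftrightarrow> g \<in> H"
proof -
  have H: "subgroup H G" using assms normal_imp_subgroup by blast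
  have "g <# (a <# H) = (g \<otimes> a) <# H"
    using assms H by (simp add: lcos_m_assoc subgroup.subset)
  then have "g <# (a <# H) = a <# H \<longleftrightarrow> inv a \<otimes> g \<otimes> a \<in> H"
    using l_coset_eq_iff[OF H, of a "g \<otimes> a"] assms by (auto simp: m_assoc)
  also have "\<dots> \<longleftrightarrow> g \<in> H"
  proof
    assume "g \<in> H"
    then show "inv a \<otimes> g \<otimes> a \<in> H"
      using normal.inv_op_closed1[OF assms(1,2)] by blast
  next
    assume "inv a \<otimes> g \<otimes> a \<in> H"
    then have "a \<otimes> (inv a \<otimes> g \<otimes> a) \<otimes> inv a \<in> H"
      using normal.inv_op_closed2[OF assms(1,2)] by blast
    moreover have "a \<otimes> (inv a \<otimes> g \<otimes> a) \<otimes> inv a = g"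
      using assms(2,3) by (simp add: inv_solve_right' m_assoc[symmetric])
    ultimately show "g \<in> H" by simp
  qed
  finally show ?thesis .
qed

end

section \<open>Fibres of maps from compact spaces\<close>

text \<open>A continuous map from a compact space to a Hausdorff space is closed, and closed maps
  have this tube property around fibres.\<close>

lemma compact_fibre_neighbourhood:
  assumes f: "continuous_map X Y f" and X: "compact_space X" and Y: "Hausdorff_space Y"
    and y: "y \<in> topspace Y" and U: "openin X U" "{x \<in> topspace X. f x = y} \<subseteq> U"
  obtains V where "openin Y V" "y \<in> V" "{x \<in> topspace X. f x \<in> V} \<subseteq> U"
proof -
  have "closed_map X Y f" by (rule continuous_imp_closed_map[OF f X Y])
  then show ?thesis using that y U unfolding closed_map_fibre_neighbourhood by meson
qed

text \<open>Having a fibre inside a small ball is an open condition on the base point, by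
  \<open>compact_fibre_neighbourhood\<close>. The open sets \<open>thin n\<close> express this for
  radius \<open>inverse (Suc n)\<close>. A point in all of them has a fibre of diameter zero,
  nonempty by surjectivity.\<close>

lemma gdelta_in_injectivity_points:
  assumes X: "compact_space X" "metrizable_space X" and Y: "Hausdorff_space Y"
    and f: "continuous_map X Y f" "f ` topspace X = topspace Y"
  shows "gdelta_in Y (injectivity_points X Y f)"
proof -
  obtain M d where "Metric_space M d" and XM: "X = Metric_space.mtopology M d"
    using X by (auto simp: metrizable_space_def)
  interpret Metric_space M d by fact
  define thin where "thin n = \<Union>{O'. openin Y O' \<and>
      (\<exists>c\<in>M. {x \<in> topspace X. f x \<in> O'} \<subseteq> mball c (inverse (Suc n)))}" for n
  have op: "openin Y (thin n)" for n
    unfolding thin_def by blast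
  have "injectivity_points X Y f = \<Inter>(range thin)"
  proof
    show "injectivity_points X Y f \<subseteq> \<Inter>(range thin)"
    proof clarify
      fix y n assume "y \<in> injectivity_points X Y f"
      then obtain x where "x \<in> M" and y: "y \<in> topspace Y" and x: "{z \<in> topspace X. f z = y} \<subseteq> {x}"
        by (auto simp: injectivity_points_def XM)
      then have "{z \<in> topspace X. f z = y} \<subseteq> mball x (inverse (Suc n))" by auto
      then obtain V where "openin Y V" "y \<in> V" "{z \<in> topspace X. f z \<in> V} \<subseteq> mball x (inverse (Suc n))"
        using compact_fibre_neighbourhood[OF f(1) X(1) Y y, of "mball x (inverse (Suc n))"]
          openin_mball[of x "inverse (Suc n)"] unfolding XM by metis
      with \<open>x \<in> M\<close> show "y \<in> thin n" unfolding thin_def by blast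
    qed
    show "\<Inter>(range thin) \<subseteq> injectivity_points X Y f"
    proof
      fix y assume y: "y \<in> \<Inter>(range thin)"
      then have "y \<in> topspace Y" using openin_subset[OF op[of 0]] by auto
      then obtain x where x: "x \<in> topspace X" "f x = y" by (metis f(2) imageE)
      have "x' = x" if x': "x' \<in> topspace X" "f x' = y" for x'
      proof (rule ccontr)
        assume "x' \<noteq> x"
        \<comment> \<open>Half the distance suffices, because two points of one ball are closer than
          twice its radius.\<close>
        then have "d x x' / 2 > 0" using x x' by (simp add: XM)
        then obtain n where n: "inverse (real (Suc n)) < d x x' / 2" using reals_Archimedean by blast
        obtain c where "c \<in> M" "x \<in> mball c (inverse (Suc n))" "x' \<in> mball c (inverse (Suc n))"
        proof -
          have "y \<in> thin n" using y by simp
          then obtain O' c where "y \<in> O'" "c \<in> M"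
            and "{x \<in> topspace X. f x \<in> O'} \<subseteq> mball c (inverse (Suc n))"
            unfolding thin_def by blast
          then show ?thesis using that x x' by (metis (mono_tags, lifting) mem_Collect_eq subsetD)
        qed
        then have "d x x' < inverse (Suc n) + inverse (Suc n)"
          using triangle[of x c x'] commute[of x c] by auto
        then show False using n by auto
      qed
      with x \<open>y \<in> topspace Y\<close> show "y \<in> injectivity_points X Y f"
        by (auto simp: injectivity_points_def)
    qed
  qed
  then show ?thesis
    using gdelta_in_Inter[of "range thin" Y] open_imp_gdelta_in[OF op] by auto
qed

section \<open>Clopen return sets in minimal systems\<close>

locale minimal_action = group G for G (structure) +
  fixes X :: "'x topology" and \<phi> :: "'a \<Rightarrow> 'x \<Rightarrow> 'x"
  assumes minimal: "minimal_system G X \<phi>"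
begin

lemma compact_X: "compact_space X"
  and metrizable_X: "metrizable_space X"
  and homeomorphic_act: "g \<in> carrier G \<Longrightarrow> homeomorphic_map X X (\<phi> g)"
  using minimal by (auto simp: minimal_system_def topological_dynamical_system_def)

sublocale act: group_action G "topspace X" \<phi>
  using minimal by (auto simp: minimal_system_def topological_dynamical_system_def)

lemma act_in [simp]: "g \<in> carrier G \<Longrightarrow> x \<in> topspace X \<Longrightarrow> \<phi> g x \<in> topspace X"
  using act.element_image by blast

lemma act_one [simp]: "x \<in> topspace X \<Longrightarrow> \<phi> \<one> x = x"
  by (metis act.id_eq_one restrict_apply')

lemma act_inv [simp]:
  assumes "g \<in> carrier G" "x \<in> topspace X"
  shows "\<phi> (inv g) (\<phi> g x) = x" "\<phi> g (\<phi> (inv g) x) = x"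
  using assms by (simp_all flip: act.composition_rule)

lemma act_image: "g \<in> carrier G \<Longrightarrow> S \<subseteq> topspace X \<Longrightarrow> \<phi> g ` (X closure_of S) = X closure_of (\<phi> g ` S)"
  by (simp add: homeomorphic_map_closure_of[OF homeomorphic_act])

lemma openin_act_vimage:
  assumes "g \<in> carrier G" "openin X U"
  shows "openin X {z \<in> topspace X. \<phi> g z \<in> U}"
  using assms homeomorphic_act homeomorphic_imp_continuous_map openin_continuous_map_preimage by blast

lemma closedin_act_vimage:
  assumes "g \<in> carrier G" "closedin X U"
  shows "closedin X {z \<in> topspace X. \<phi> g z \<in> U}"
  using assms homeomorphic_act homeomorphic_imp_continuous_map closedin_continuous_map_preimage by blast

lemma closure_of_orbit: "x \<in> topspace X \<Longrightarrow> X closure_of (orbit G \<phi> x) = topspace X"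
  using minimal by (auto simp: minimal_system_def)

lemma orbit_meets_open:
  assumes "x \<in> topspace X" "openin X U" "U \<noteq> {}"
  obtains g where "g \<in> carrier G" "\<phi> g x \<in> U"
proof -
  obtain u where "u \<in> U" using assms by blast
  then have "u \<in> X closure_of (orbit G \<phi> x)"
    using assms openin_subset closure_of_orbit by blast
  then obtain y where "y \<in> orbit G \<phi> x" "y \<in> U"
    using assms \<open>u \<in> U\<close> by (meson in_closure_of)
  then show ?thesis using that by (auto simp: orbit_def)
qed

text \<open>For a normal syndetic \<open>N\<close> the relation \<open>near N\<close> turns out to be an equivalence with
  finitely many closed classes; these are the minimal components of the \<open>N\<close>-action.\<close>

definition near :: "'a set \<Rightarrow> 'x \<Rightarrow> 'x \<Rightarrow> bool" where
  "near N a b \<longleftrightarrow> a \<in> X closure_of ((\<lambda>n. \<phi> n b) ` N)"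

section \<open>Orbit closures of a finite-index normal subgroup as clopen classes\<close>

context
  fixes N assumes normal: "N \<lhd> G" and syndetic: "syndetic_subgroup G N"
begin

interpretation N: normal N G by (rule normal)

lemma near_topspace: "near N a b \<Longrightarrow> a \<in> topspace X"
  using closure_of_subset_topspace by (force simp: near_def)

text \<open>Normality lets \<open>g\<close> carry the \<open>N\<close>-orbit of \<open>b\<close>
  into the \<open>N\<close>-orbit of \<open>\<phi> g b\<close>, and a homeomorphism commutes with
  closure.\<close>

lemma near_act:
  assumes "near N a b" "b \<in> topspace X" "g \<in> carrier G"
  shows "near N (\<phi> g a) (\<phi> g b)"
proof -
  have "\<phi> g (\<phi> n b) = \<phi> (g \<otimes> n \<otimes> inv g) (\<phi> g b)" if "n \<in> N" for n
    using assms that by (simp flip: act.composition_rule add: m_assoc)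
  then have "\<phi> g ` (\<lambda>n. \<phi> n b) ` N \<subseteq> (\<lambda>n. \<phi> n (\<phi> g b)) ` N"
    using N.inv_op_closed2[OF assms(3)] by fastforce
  moreover have "\<phi> g a \<in> X closure_of (\<phi> g ` (\<lambda>n. \<phi> n b) ` N)"
    using assms act_image[of g "(\<lambda>n. \<phi> n b) ` N"] by (force simp: near_def)
  ultimately show ?thesis
    unfolding near_def using closure_of_mono by blast
qed

lemma near_translate:
  assumes "b \<in> topspace X" "n \<in> N"
  shows "near N (\<phi> n b) b"
proof -
  have "(\<lambda>n. \<phi> n b) ` N \<subseteq> topspace X" using assms by auto
  then show ?thesis
    unfolding near_def using closure_of_subset assms by blast
qed

text \<open>The closure of the \<open>N\<close>-orbit of \<open>c\<close> is closed and
  \<open>N\<close>-invariant. It contains \<open>b\<close>, hence the whole \<open>N\<close>-orbit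
  closure of \<open>b\<close>.\<close>

lemma near_trans:
  assumes ab: "near N a b" and bc: "near N b c" and c: "c \<in> topspace X"
  shows "near N a c"
proof -
  have "\<phi> n b \<in> X closure_of ((\<lambda>n. \<phi> n c) ` N)" if n: "n \<in> N" for n
  proof -
    have "\<phi> n ` (\<lambda>n. \<phi> n c) ` N \<subseteq> (\<lambda>n. \<phi> n c) ` N"
      using n c by (force simp flip: act.composition_rule)
    moreover have "\<phi> n b \<in> X closure_of (\<phi> n ` (\<lambda>n. \<phi> n c) ` N)"
      using bc n c act_image[of n "(\<lambda>n. \<phi> n c) ` N"] by (force simp: near_def)
    ultimately show ?thesis using closure_of_mono by blast
  qed
  then have "X closure_of ((\<lambda>n. \<phi> n b) ` N) \<subseteq> X closure_of ((\<lambda>n. \<phi> n c) ` N)"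
    by (intro closure_of_minimal) auto
  then show ?thesis using ab by (auto simp: near_def)
qed

text \<open>The \<open>G\<close>-orbit of \<open>a\<close> is a finite union of
  \<open>N\<close>-orbits of translates of \<open>a\<close>, since left and right cosets of
  \<open>N\<close> agree. Closure commutes with finite unions, so by minimality finitely many
  \<open>N\<close>-orbit closures cover \<open>X\<close>.\<close>

lemma near_some_translate:
  assumes "a \<in> topspace X" "b \<in> topspace X"
  obtains k where "k \<in> carrier G" "near N b (\<phi> k a)"
proof -
  have "orbit G \<phi> a = \<Union>((\<lambda>C. (\<lambda>g. \<phi> g a) ` C) ` (lcosets N))"
    using lcosets_part_G[OF N.subgroup_axioms] by (auto simp: orbit_def)
  moreover have "finite (lcosets N)"
    using syndetic by (simp add: syndetic_subgroup_def)
  ultimately have "X closure_of (orbit G \<phi> a) = (\<Union>C\<in>lcosets N. X closure_of ((\<lambda>g. \<phi> g a) ` C))"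
    by (simp add: closure_of_Union)
  then obtain C where "C \<in> lcosets N" "b \<in> X closure_of ((\<lambda>g. \<phi> g a) ` C)"
    using assms closure_of_orbit by blast
  then obtain k where k: "k \<in> carrier G" and b: "b \<in> X closure_of ((\<lambda>g. \<phi> g a) ` (k <# N))"
    by (auto simp: LCOSETS_def)
  have "k <# N = N #> k" using k N.coset_eq by simp
  then have "(\<lambda>g. \<phi> g a) ` (k <# N) = (\<lambda>n. \<phi> n (\<phi> k a)) ` N"
    using k assms by (auto simp: r_coset_def act.composition_rule image_iff)
  with b k that show ?thesis by (simp add: near_def)
qed

text \<open>Write \<open>a \<le> b\<close> for \<open>near N a b\<close>. If \<open>z \<le> k a\<close> and \<open>a \<le> z\<close> then \<open>z \<le> k a \<le> k\<^sup>2 a \<le> \<dots>\<close>, and some positive power of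
  \<open>k\<close> lies in \<open>N\<close>.\<close>

lemma near_sym:
  assumes az: "near N a z" and z: "z \<in> topspace X"
  shows "near N z a"
proof -
  have a: "a \<in> topspace X" using az near_topspace by blast
  obtain k where k: "k \<in> carrier G" and zk: "near N z (\<phi> k a)"
    using near_some_translate[OF a z] .
  have ak: "near N a (\<phi> k a)"
    using near_trans[OF az zk] a k by simp
  have "near N z (\<phi> (k [^] Suc m) a)" for m :: nat
  proof (induction m)
    case 0
    then show ?case using zk k by simp
  next
    case (Suc m)
    have "near N (\<phi> (k [^] Suc m) a) (\<phi> (k [^] Suc m) (\<phi> k a))"
      using ak a k by (intro near_act) auto
    then have "near N (\<phi> (k [^] Suc m) a) (\<phi> (k [^] Suc (Suc m)) a)"
      using a k by (simp flip: act.composition_rule)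
    then show ?case using near_trans[OF Suc] a k by simp
  qed
  moreover obtain m :: nat where "m > 0" "k [^] m \<in> N"
    using pow_mem_syndetic_subgroup[OF syndetic k] .
  ultimately show ?thesis
    using near_trans[OF _ near_translate] a by (metis gr0_implies_Suc)
qed

lemma near_refl: "x \<in> topspace X \<Longrightarrow> near N x x"
  using near_translate[of x \<one>] by simp

lemma closedin_near: "closedin X {z. near N z x}"
  by (simp add: near_def)

text \<open>Finitely many closed classes cover \<open>X\<close>, so the complement of one class is
  the union of those disjoint from it and is closed.\<close>

lemma openin_near:
  assumes x: "x \<in> topspace X"
  shows "openin X {z. near N z x}"
proof -
  define F where "F = {C \<in> lcosets N. X closure_of ((\<lambda>g. \<phi> g x) ` C) \<inter> {z. near N z x} = {}}"
  have "finite F"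
    using syndetic by (simp add: F_def syndetic_subgroup_def)
  have "z \<in> (\<Union>C\<in>F. X closure_of ((\<lambda>g. \<phi> g x) ` C))" if z: "z \<in> topspace X" "\<not> near N z x" for z
  proof -
    obtain k where k: "k \<in> carrier G" "near N z (\<phi> k x)"
      using near_some_translate[OF x z(1)] .
    have "k <# N = N #> k" using k N.coset_eq by simp
    then have eq: "(\<lambda>g. \<phi> g x) ` (k <# N) = (\<lambda>n. \<phi> n (\<phi> k x)) ` N"
      using k x by (auto simp: r_coset_def act.composition_rule image_iff)
    \<comment> \<open>By symmetry and transitivity, a common point \<open>w\<close> of the two
      classes would put \<open>z\<close> in the class of \<open>x\<close>.\<close>
    have "\<not> near N w x" if "near N w (\<phi> k x)" for w
      using that near_sym near_trans k x z by (meson act_in)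
    then have "X closure_of ((\<lambda>g. \<phi> g x) ` (k <# N)) \<inter> {z. near N z x} = {}"
      unfolding eq by (auto simp: near_def)
    then have "k <# N \<in> F"
      using k by (auto simp: F_def LCOSETS_def)
    then show ?thesis using k eq by (intro UN_I[of "k <# N"]) (auto simp: near_def)
  qed
  then have "topspace X - {z. near N z x} = (\<Union>C\<in>F. X closure_of ((\<lambda>g. \<phi> g x) ` C))"
    using closure_of_subset_topspace[of X] by (fastforce simp: F_def)
  moreover have "closedin X (\<Union>C\<in>F. X closure_of ((\<lambda>g. \<phi> g x) ` C))"
    using \<open>finite F\<close> by (intro closedin_Union) auto
  ultimately show ?thesis
    using near_topspace by (simp add: openin_closedin_eq subset_iff)
qed

text \<open>The action permutes the classes, so the return set is the stabiliser of the class of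
  \<open>x\<close>. It contains \<open>N\<close>, which gives finite index.\<close>

lemma return_times_near:
  assumes x: "x \<in> topspace X"
  shows "syndetic_subgroup G (return_times G \<phi> {z. near N z x} x)"
proof (rule syndetic_subgroup_mono[OF syndetic])
  let ?R = "return_times G \<phi> {z. near N z x} x"
  show "N \<subseteq> ?R"
    using near_translate[OF x] by (auto simp: return_times_def)
  show "subgroup ?R G"
  proof (rule subgroupI)
    show "?R \<subseteq> carrier G" by (auto simp: return_times_def)
    show "?R \<noteq> {}" using \<open>N \<subseteq> ?R\<close> N.one_closed by blast
    fix g assume g: "g \<in> ?R"
    then have "near N (\<phi> (inv g) x) (\<phi> (inv g) (\<phi> g x))"
      using x near_act[OF near_sym[of "\<phi> g x" x], of "inv g"] by (simp add: return_times_def)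
    then show "inv g \<in> ?R"
      using g x by (simp add: return_times_def)
    fix h assume h: "h \<in> ?R"
    have "near N (\<phi> g (\<phi> h x)) (\<phi> g x)"
      using g h x near_act by (simp add: return_times_def)
    then show "g \<otimes> h \<in> ?R"
      using g h x near_trans by (auto simp: return_times_def act.composition_rule)
  qed
qed

end

text \<open>The set \<open>W\<close> is the class of \<open>x\<close> for the normal core of a
  subgroup returning \<open>x\<close> to \<open>U\<close>. Taking a closure may leave
  \<open>U\<close>, so a closed \<open>K\<close> is placed between \<open>U\<close> and
  \<open>V\<close> to contain the class.\<close>

lemma regularly_recurrent_clopen:
  assumes rr: "regularly_recurrent_point G X \<phi> x" and V: "openin X V" "x \<in> V"
  obtains W where "openin X W" "closedin X W" "x \<in> W" "W \<subseteq> V"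
    "syndetic_subgroup G (return_times G \<phi> W x)"
proof -
  have x: "x \<in> topspace X" using rr by (simp add: regularly_recurrent_point_def)
  have "neighbourhood_base_of (closedin X) X"
    by (simp add: neighbourhood_base_of_closedin metrizable_imp_regular_space metrizable_X)
  then obtain U K where U: "openin X U" "closedin X K" "x \<in> U" "U \<subseteq> K" "K \<subseteq> V"
    using V unfolding neighbourhood_base_of by meson
  then obtain H where H: "syndetic_subgroup G H" "H \<subseteq> return_times G \<phi> U x"
    using rr by (auto simp: regularly_recurrent_point_def)
  let ?N = "normal_core H"
  have sub: "subgroup H G" using H by (simp add: syndetic_subgroup_def)
  note N = normal_normal_core[OF sub] syndetic_normal_core[OF H(1)]
  have "(\<lambda>n. \<phi> n x) ` ?N \<subseteq> K"
    using normal_core_subset[OF sub] H(2) U by (auto simp: return_times_def)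
  then have "{z. near ?N z x} \<subseteq> K"
    using closure_of_minimal[of _ K X] U(2) unfolding near_def by blast
  then show ?thesis
    using that[of "{z. near ?N z x}"] U near_refl[OF N x] openin_near[OF N x] closedin_near[OF N]
      return_times_near[OF N x] by auto
qed

end
section \<open>Subodometer factors\<close>

lemma topspace_subodometer:
  "topspace (subodometer G \<Gamma>) =
     {y. (\<forall>i. y i \<in> lcosets\<^bsub>G\<^esub> (\<Gamma> i)) \<and> (\<forall>i. coset_projection G (\<Gamma> i) (y (Suc i)) = y i)}"
  by (auto simp: subodometer_def)

lemma Hausdorff_space_subodometer: "Hausdorff_space (subodometer G \<Gamma>)"
  by (simp add: subodometer_def Hausdorff_space_subtopology Hausdorff_space_product_topology)

lemma continuous_map_subodometer_coordinate:
  "continuous_map (subodometer G \<Gamma>) (discrete_topology (lcosets\<^bsub>G\<^esub> (\<Gamma> i))) (\<lambda>y. y i)"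
  unfolding subodometer_def
  by (intro continuous_map_from_subtopology continuous_map_product_coordinates) simp

lemma subodometer_eq_coordinate_mono:
  assumes "y \<in> topspace (subodometer G \<Gamma>)" "z \<in> topspace (subodometer G \<Gamma>)"
    and "i \<le> j" "z j = y j"
  shows "z i = y i"
  using \<open>i \<le> j\<close> \<open>z j = y j\<close>
proof (induction rule: inc_induct)
  case (step n)
  then have "coset_projection G (\<Gamma> n) (z (Suc n)) = coset_projection G (\<Gamma> n) (y (Suc n))"
    by simp
  then show ?case using assms(1,2) by (simp add: topspace_subodometer)
qed

text \<open>A basic open set constrains finitely many coordinates, and a single coordinate of large
  index determines all earlier ones through the projections. Thus cylinders on one coordinate form a
  neighbourhood base.\<close>

lemma subodometer_cylinder_subset:
  assumes "openin (subodometer G \<Gamma>) U" "y \<in> U"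
  obtains i where "{z \<in> topspace (subodometer G \<Gamma>). z i = y i} \<subseteq> U"
proof -
  let ?S = "{y. \<forall>i. coset_projection G (\<Gamma> i) (y (Suc i)) = y i}"
  let ?T = "\<lambda>i. discrete_topology (lcosets\<^bsub>G\<^esub> (\<Gamma> i))"
  have y: "y \<in> topspace (subodometer G \<Gamma>)" using assms openin_subset by blast
  obtain U' where U': "openin (product_topology ?T UNIV) U'" "U = U' \<inter> ?S"
    using assms(1) unfolding subodometer_def openin_subtopology by blast
  then obtain B where fin: "finite {i. B i \<noteq> topspace (?T i)}"
    and B: "y \<in> Pi\<^sub>E UNIV B" "Pi\<^sub>E UNIV B \<subseteq> U'"
    using assms(2) by (auto simp: openin_product_topology_alt)
  obtain j where j: "\<And>i. B i \<noteq> topspace (?T i) \<Longrightarrow> i \<le> j"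
    using fin by (metis (mono_tags, lifting) finite_nat_set_iff_bounded_le mem_Collect_eq)
  have "z \<in> U" if z: "z \<in> topspace (subodometer G \<Gamma>)" "z j = y j" for z
  proof -
    have "z i \<in> B i" for i
    proof (cases "B i = topspace (?T i)")
      case True
      then show ?thesis using z by (simp add: topspace_subodometer)
    next
      case False
      then have "z i = y i" using subodometer_eq_coordinate_mono[OF y z(1) j z(2)] by blast
      then show ?thesis using B by auto
    qed
    then show ?thesis using B z by (auto simp: U'(2) topspace_subodometer)
  qed
  then show ?thesis using that by blast
qed

lemma subodometer_action_apply:
  "y \<in> topspace (subodometer G \<Gamma>) \<Longrightarrow> subodometer_action G \<Gamma> g y i = l_coset G g (y i)"
  by (simp add: subodometer_action_def)

text \<open>The sequence of trivial cosets is a coherent point. Nonemptiness is what later turns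
  density of the injectivity points into existence of one.\<close>

lemma (in group) topspace_subodometer_nonempty:
  assumes "subodometer_sequence G \<Gamma>"
  shows "topspace (subodometer G \<Gamma>) \<noteq> {}"
proof -
  have sub: "subgroup (\<Gamma> i) G" and dec: "\<Gamma> (Suc i) \<subseteq> \<Gamma> i" for i
    using assms by (auto simp: subodometer_sequence_def syndetic_subgroup_def)
  have "(\<lambda>i. \<one> <# \<Gamma> i) \<in> topspace (subodometer G \<Gamma>)"
    using coset_projection_l_coset[OF is_group sub sub dec one_closed]
    by (auto simp: topspace_subodometer LCOSETS_def)
  then show ?thesis by blast
qed

section \<open>Coset codes of clopen return sets, and fibres through recurrent points\<close>

context minimal_action
begin

text \<open>The code records which translates of \<open>W\<close> contain \<open>z\<close>. The
  inverse makes it equivariant for left multiplication, matching the action on left cosets.\<close>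

definition coset_code :: "'x set \<Rightarrow> 'x \<Rightarrow> 'a set" where
  "coset_code W z = {g \<in> carrier G. \<phi> (inv g) z \<in> W}"

lemma one_in_coset_code: "z \<in> topspace X \<Longrightarrow> \<one> \<in> coset_code W z \<longleftrightarrow> z \<in> W"
  by (simp add: coset_code_def)

lemma coset_code_act:
  assumes "h \<in> carrier G" "z \<in> topspace X"
  shows "coset_code W (\<phi> h z) = h <# coset_code W z"
proof (intro equalityI subsetI)
  fix g assume g: "g \<in> coset_code W (\<phi> h z)"
  then have "inv h \<otimes> g \<in> coset_code W z"
    using assms by (simp add: coset_code_def inv_mult_group act.composition_rule)
  moreover have "g = h \<otimes> (inv h \<otimes> g)"
    using g assms by (simp add: coset_code_def m_assoc[symmetric])
  ultimately show "g \<in> h <# coset_code W z"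
    unfolding l_coset_def by blast
next
  fix g assume "g \<in> h <# coset_code W z"
  then obtain k where "k \<in> coset_code W z" "g = h \<otimes> k"
    by (auto simp: l_coset_def)
  then show "g \<in> coset_code W (\<phi> h z)"
    using assms by (simp add: coset_code_def inv_mult_group act.composition_rule)
qed

lemma coset_code_act_cancel:
  assumes "h \<in> carrier G" "y \<in> topspace X" "z \<in> topspace X"
    and "coset_code W (\<phi> h y) = coset_code W (\<phi> h z)"
  shows "coset_code W y = coset_code W z"
  using coset_code_act[of "inv h" "\<phi> h y" W] coset_code_act[of "inv h" "\<phi> h z" W] assms by simp

text \<open>By minimality every orbit meets \<open>W\<close>, so the translates of \<open>W\<close>
  cover \<open>X\<close>.\<close>

lemma coset_code_nonempty:
  assumes "openin X W" "W \<noteq> {}" "z \<in> topspace X"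
  obtains g where "g \<in> coset_code W z"
proof -
  obtain k where "k \<in> carrier G" "\<phi> k z \<in> W"
    using orbit_meets_open[OF assms(3,1,2)] .
  then show ?thesis using that[of "inv k"] by (simp add: coset_code_def)
qed

context
  fixes W x
  assumes openW: "openin X W" and closedW: "closedin X W" and xW: "x \<in> W"
    and sub: "subgroup (return_times G \<phi> W x) G"
begin

lemma return_point_in_topspace: "x \<in> topspace X"
  using openW xW openin_subset by blast

text \<open>Membership of \<open>h\<close> says that \<open>inv h \<otimes> g\<close> is a return
  time. Closure of the return set under inverses turns this into the coset condition on
  \<open>inv g \<otimes> h\<close>.\<close>

lemma coset_code_orbit:
  assumes "g \<in> carrier G"
  shows "coset_code W (\<phi> g x) = g <# return_times G \<phi> W x"
proof -
  have "h \<in> coset_code W (\<phi> g x) \<longleftrightarrow> h \<in> g <# return_times G \<phi> W x" if h: "h \<in> carrier G" for h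
  proof -
    have "\<phi> (inv h \<otimes> g) x = \<phi> (inv h) (\<phi> g x)"
      by (rule act.composition_rule[OF return_point_in_topspace inv_closed[OF h] assms])
    then have "h \<in> coset_code W (\<phi> g x) \<longleftrightarrow> inv h \<otimes> g \<in> return_times G \<phi> W x"
      using h assms by (simp add: coset_code_def return_times_def)
    also have "\<dots> \<longleftrightarrow> inv g \<otimes> h \<in> return_times G \<phi> W x"
    proof -
      have "inv (inv h \<otimes> g) = inv g \<otimes> h" "inv (inv g \<otimes> h) = inv h \<otimes> g"
        using h assms by (simp_all add: inv_mult_group)
      then show ?thesis using subgroup.m_inv_closed[OF sub] by metis
    qed
    finally show ?thesis
      using h assms by (simp add: mem_l_coset_iff[OF sub])
  qed
  moreover have "coset_code W (\<phi> g x) \<subseteq> carrier G" "g <# return_times G \<phi> W x \<subseteq> carrier G"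
    using assms by (auto simp: coset_code_def mem_l_coset_iff[OF sub])
  ultimately show ?thesis by blast
qed

lemma openin_translate: "g \<in> carrier G \<Longrightarrow> openin X {z \<in> topspace X. g \<in> coset_code W z}"
  using openin_act_vimage[OF _ openW, of "inv g"] by (simp add: coset_code_def)

lemma closedin_translate: "g \<in> carrier G \<Longrightarrow> closedin X {z \<in> topspace X. g \<in> coset_code W z}"
  using closedin_act_vimage[OF _ closedW, of "inv g"] by (simp add: coset_code_def)

text \<open>Membership of \<open>g\<close> and \<open>h\<close> in the code is a clopen condition, so it suffices to compare
  with a point of the dense orbit of \<open>x\<close>.\<close>

lemma coset_code_eq:
  assumes z: "z \<in> topspace X" and g: "g \<in> coset_code W z"
  shows "coset_code W z = g <# return_times G \<phi> W x"
proof -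
  let ?R = "return_times G \<phi> W x"
  let ?A = "\<lambda>g. {z \<in> topspace X. g \<in> coset_code W z}"
  have gG: "g \<in> carrier G" using g by (simp add: coset_code_def)
  have orbit: "k <# ?R = g <# ?R" if "k \<in> carrier G" "\<phi> k x \<in> ?A g" for k
  proof -
    have "g \<in> k <# ?R" using that coset_code_orbit by simp
    then show ?thesis using l_repr_independence that(1) sub by blast
  qed
  have "h \<in> coset_code W z \<longleftrightarrow> h \<in> g <# ?R" if h: "h \<in> carrier G" for h
  proof
    assume "h \<in> coset_code W z"
    then have "?A g \<inter> ?A h \<noteq> {}" using g z by blast
    then obtain k where k: "k \<in> carrier G" "\<phi> k x \<in> ?A g \<inter> ?A h"
      using orbit_meets_open[OF return_point_in_topspace openin_Int[OF openin_translate[OF gG] openin_translate[OF h]]]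
      by blast
    then have "h \<in> k <# ?R" using coset_code_orbit by simp
    then show "h \<in> g <# ?R" using orbit k by blast
  next
    assume hR: "h \<in> g <# ?R"
    show "h \<in> coset_code W z"
    proof (rule ccontr)
      assume "h \<notin> coset_code W z"
      then have "?A g - ?A h \<noteq> {}" using g z by blast
      then obtain k where k: "k \<in> carrier G" "\<phi> k x \<in> ?A g - ?A h"
        using orbit_meets_open[OF return_point_in_topspace openin_diff[OF openin_translate[OF gG] closedin_translate[OF h]]]
        by blast
      then have "h \<notin> k <# ?R" using coset_code_orbit return_point_in_topspace by simp
      then show False using orbit k hR by blast
    qed
  qed
  moreover have "coset_code W z \<subseteq> carrier G" "g <# ?R \<subseteq> carrier G"
    using gG by (auto simp: coset_code_def mem_l_coset_iff[OF sub])
  ultimately show ?thesis by blast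
qed

lemma coset_code_in_lcosets:
  assumes "z \<in> topspace X"
  shows "coset_code W z \<in> lcosets (return_times G \<phi> W x)"
proof -
  obtain g where g: "g \<in> coset_code W z"
    using coset_code_nonempty[OF openW _ assms] xW by blast
  then have "g \<in> carrier G" by (simp add: coset_code_def)
  with coset_code_eq[OF assms g] show ?thesis by (auto simp: LCOSETS_def)
qed

text \<open>By \<open>coset_code_eq\<close> one element already determines the code, so each fibre
  over a coset is a translate of \<open>W\<close> and hence clopen.\<close>

lemma coset_code_fibre:
  assumes "g \<in> carrier G"
  shows "{z \<in> topspace X. coset_code W z = g <# return_times G \<phi> W x} =
         {z \<in> topspace X. g \<in> coset_code W z}"
  using coset_code_eq lcos_self[OF assms sub] by blast

lemma openin_coset_code_fibre: "openin X {z \<in> topspace X. coset_code W z = C}"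
proof (cases "C \<in> lcosets (return_times G \<phi> W x)")
  case True
  then show ?thesis using coset_code_fibre openin_translate by (auto simp: LCOSETS_def)
next
  case False
  then have "{z \<in> topspace X. coset_code W z = C} = {}" using coset_code_in_lcosets by blast
  then show ?thesis by (simp only: openin_empty)
qed

lemma continuous_map_coset_code:
  "continuous_map X (discrete_topology (lcosets (return_times G \<phi> W x))) (coset_code W)"
proof -
  have "openin X {z \<in> topspace X. coset_code W z \<in> U}" for U
  proof -
    have "{z \<in> topspace X. coset_code W z \<in> U} = (\<Union>C\<in>U. {z \<in> topspace X. coset_code W z = C})"
      by blast
    also have "openin X \<dots>" by (intro openin_Union) (auto simp: openin_coset_code_fibre)
    finally show ?thesis .
  qed
  then show ?thesis using coset_code_in_lcosets by (auto simp: continuous_map)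
qed

end

text \<open>A clopen return set of \<open>x\<close> has a locally constant code, so \<open>x\<close> and any other point of its
  fibre have the same code as soon as some translate of the fibre enters a small neighbourhood of
  a singleton fibre.\<close>

lemma regularly_recurrent_imp_injectivity_point:
  assumes rr: "regularly_recurrent_point G X \<phi> x"
    and \<pi>: "factor_map G X \<phi> Y \<psi> \<pi>" and Y: "Hausdorff_space Y"
    and y0: "y0 \<in> injectivity_points X Y \<pi>"
  shows "\<pi> x \<in> injectivity_points X Y \<pi>"
proof -
  have x: "x \<in> topspace X" using rr by (simp add: regularly_recurrent_point_def)
  have cont: "continuous_map X Y \<pi>" and surj: "\<pi> ` topspace X = topspace Y"
    and equiv: "\<And>g z. g \<in> carrier G \<Longrightarrow> z \<in> topspace X \<Longrightarrow> \<pi> (\<phi> g z) = \<psi> g (\<pi> z)"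
    using \<pi> by (auto simp: factor_map_def)
  obtain x0 where x0: "x0 \<in> topspace X" "\<pi> x0 = y0" "{z \<in> topspace X. \<pi> z = y0} \<subseteq> {x0}"
    and y0Y: "y0 \<in> topspace Y"
    using y0 by (auto simp: injectivity_points_def)
  have "x' = x" if x': "x' \<in> topspace X" "\<pi> x' = \<pi> x" for x'
  proof (rule ccontr)
    assume "x' \<noteq> x"
    then obtain V where V: "openin X V" "x \<in> V" "x' \<notin> V"
      using metrizable_imp_Hausdorff_space[OF metrizable_X] x x'
      unfolding Hausdorff_space_def disjnt_iff by metis
    obtain W where W: "openin X W" "closedin X W" "x \<in> W" "W \<subseteq> V"
      and R: "syndetic_subgroup G (return_times G \<phi> W x)"
      using regularly_recurrent_clopen[OF rr V(1,2)] .
    have sub: "subgroup (return_times G \<phi> W x) G" using R by (simp add: syndetic_subgroup_def)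
    \<comment> \<open>Since \<open>x0\<close> is the only point over \<open>y0\<close>, this open
      set contains the entire fibre over \<open>y0\<close>.\<close>
    define F where "F = {z \<in> topspace X. coset_code W z = coset_code W x0}"
    have "openin X F" unfolding F_def by (rule openin_coset_code_fibre[OF W(1-3) sub])
    moreover have "{z \<in> topspace X. \<pi> z = y0} \<subseteq> F" using x0 by (auto simp: F_def)
    ultimately obtain U where U: "openin Y U" "y0 \<in> U" "{z \<in> topspace X. \<pi> z \<in> U} \<subseteq> F"
      using compact_fibre_neighbourhood[OF cont compact_X Y y0Y, of F] by blast
    have "x0 \<in> {z \<in> topspace X. \<pi> z \<in> U}" using x0 U(2) by simp
    then obtain g where g: "g \<in> carrier G" "\<pi> (\<phi> g x) \<in> U"
      using orbit_meets_open[OF x openin_continuous_map_preimage[OF cont U(1)]] by blast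
    then have "\<pi> (\<phi> g x') \<in> U" using equiv x x' by simp
    then have "coset_code W (\<phi> g x) = coset_code W (\<phi> g x')"
      using g U(3) x x' by (auto simp: F_def subset_iff)
    then have "coset_code W x = coset_code W x'"
      using coset_code_act_cancel g x x' by blast
    then have "x' \<in> W"
      using one_in_coset_code[of x W] one_in_coset_code[of x' W] x x' W(3) by simp
    then show False using W(4) V(3) by blast
  qed
  then show ?thesis
    using x surj by (auto simp: injectivity_points_def)
qed

section \<open>From singleton fibres to recurrence\<close>

context
  fixes \<Gamma> \<pi>
  assumes \<pi>: "factor_map G X \<phi> (subodometer G \<Gamma>) (subodometer_action G \<Gamma>) \<pi>"
begin

lemma factor_in_topspace: "z \<in> topspace X \<Longrightarrow> \<pi> z \<in> topspace (subodometer G \<Gamma>)"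
  using \<pi> by (auto simp: factor_map_def)

lemma factor_act:
  "g \<in> carrier G \<Longrightarrow> z \<in> topspace X \<Longrightarrow> \<pi> (\<phi> g z) i = g <# \<pi> z i"
  using \<pi> factor_in_topspace by (simp add: factor_map_def subodometer_action_apply)

lemma clopen_cylinder:
  assumes "x \<in> topspace X"
  shows "openin X {z \<in> topspace X. \<pi> z i = \<pi> x i}" "closedin X {z \<in> topspace X. \<pi> z i = \<pi> x i}"
proof -
  have "continuous_map X (subodometer G \<Gamma>) \<pi>" using \<pi> by (simp add: factor_map_def)
  from continuous_map_compose[OF this continuous_map_subodometer_coordinate]
  have "continuous_map X (discrete_topology (lcosets (\<Gamma> i))) (\<lambda>z. \<pi> z i)"
    by (simp add: o_def)
  moreover have "{\<pi> x i} \<subseteq> lcosets (\<Gamma> i)"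
    using factor_in_topspace[OF assms] by (auto simp: topspace_subodometer)
  ultimately show "openin X {z \<in> topspace X. \<pi> z i = \<pi> x i}" "closedin X {z \<in> topspace X. \<pi> z i = \<pi> x i}"
    using openin_continuous_map_preimage[of X _ "\<lambda>z. \<pi> z i" "{\<pi> x i}"]
      closedin_continuous_map_preimage[of X _ "\<lambda>z. \<pi> z i" "{\<pi> x i}"]
    by fastforce+
qed

lemma return_times_cylinder:
  assumes "x \<in> topspace X"
  shows "return_times G \<phi> {z \<in> topspace X. \<pi> z i = \<pi> x i} x =
         {g \<in> carrier G. g <# \<pi> x i = \<pi> x i}"
  using assms factor_act by (auto simp: return_times_def)

text \<open>The fibre through \<open>x\<close> is a singleton inside \<open>V\<close>. Compactness
  gives an open set below whose preimage stays in \<open>V\<close>, and this set contains a cylinder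
  around \<open>\<pi> x\<close>.\<close>

lemma injectivity_point_cylinder_subset:
  assumes x: "x \<in> topspace X" and inj: "\<pi> x \<in> injectivity_points X (subodometer G \<Gamma>) \<pi>"
    and V: "openin X V" "x \<in> V"
  obtains i where "{z \<in> topspace X. \<pi> z i = \<pi> x i} \<subseteq> V"
proof -
  have cont: "continuous_map X (subodometer G \<Gamma>) \<pi>"
    using \<pi> by (simp add: factor_map_def)
  have "{z \<in> topspace X. \<pi> z = \<pi> x} \<subseteq> V"
    using inj x V by (auto simp: injectivity_points_def)
  then obtain U where U: "openin (subodometer G \<Gamma>) U" "\<pi> x \<in> U" "{z \<in> topspace X. \<pi> z \<in> U} \<subseteq> V"
    using compact_fibre_neighbourhood[OF cont compact_X Hausdorff_space_subodometer
        factor_in_topspace[OF x] V(1)] by metis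
  obtain i where "{z \<in> topspace (subodometer G \<Gamma>). z i = \<pi> x i} \<subseteq> U"
    using subodometer_cylinder_subset[OF U(1,2)] .
  then have "{z \<in> topspace X. \<pi> z i = \<pi> x i} \<subseteq> V"
    using U(3) factor_in_topspace by blast
  then show ?thesis using that by blast
qed

text \<open>The return set of a cylinder is the stabiliser of the coset \<open>\<pi> x i\<close>. It
  contains the normal core of \<open>\<Gamma> i\<close>, which has finite index.\<close>

lemma injectivity_point_imp_regularly_recurrent:
  assumes \<Gamma>: "subodometer_sequence G \<Gamma>"
    and x: "x \<in> topspace X" and inj: "\<pi> x \<in> injectivity_points X (subodometer G \<Gamma>) \<pi>"
  shows "regularly_recurrent_point G X \<phi> x"
  unfolding regularly_recurrent_point_def
proof (intro conjI allI impI x)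
  fix V assume "openin X V \<and> x \<in> V"
  then obtain i where i: "{z \<in> topspace X. \<pi> z i = \<pi> x i} \<subseteq> V"
    using injectivity_point_cylinder_subset[OF x inj] by blast
  have syn: "syndetic_subgroup G (\<Gamma> i)"
    using \<Gamma> by (simp add: subodometer_sequence_def)
  have "\<pi> x i \<in> lcosets (\<Gamma> i)"
    using factor_in_topspace[OF x] by (simp add: topspace_subodometer)
  then have "normal_core (\<Gamma> i) \<subseteq> {g \<in> carrier G. g <# \<pi> x i = \<pi> x i}"
    by (auto simp: normal_core_def LCOSETS_def)
  also have "\<dots> = return_times G \<phi> {z \<in> topspace X. \<pi> z i = \<pi> x i} x"
    using return_times_cylinder[OF x] by simp
  also have "\<dots> \<subseteq> return_times G \<phi> V x"
    using i by (auto simp: return_times_def)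
  finally show "\<exists>H. syndetic_subgroup G H \<and> H \<subseteq> return_times G \<phi> V x"
    using syndetic_normal_core[OF syn] by blast
qed

text \<open>For normal \<open>\<Gamma> i\<close> the stabiliser of any coset is
  \<open>\<Gamma> i\<close>, so the cylinders themselves serve as the clopen sets
  \<open>W\<close>.\<close>

lemma injectivity_point_imp_strongly_regularly_recurrent:
  assumes \<Gamma>: "odometer_sequence G \<Gamma>"
    and x: "x \<in> topspace X" and inj: "\<pi> x \<in> injectivity_points X (subodometer G \<Gamma>) \<pi>"
  shows "strongly_regularly_recurrent_point G X \<phi> x"
  unfolding strongly_regularly_recurrent_point_def
proof (intro conjI allI impI x)
  fix V assume "openin X V \<and> x \<in> V"
  then obtain i where i: "{z \<in> topspace X. \<pi> z i = \<pi> x i} \<subseteq> V" (is "?W \<subseteq> V")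
    using injectivity_point_cylinder_subset[OF x inj] by blast
  have syn: "syndetic_subgroup G (\<Gamma> i)" and nor: "\<Gamma> i \<lhd> G"
    using \<Gamma> by (auto simp: odometer_sequence_def subodometer_sequence_def)
  obtain a where a: "a \<in> carrier G" "\<pi> x i = a <# \<Gamma> i"
    using factor_in_topspace[OF x] unfolding topspace_subodometer mem_lcosets_iff by blast
  have "\<Gamma> i \<subseteq> carrier G"
    using syn by (simp add: syndetic_subgroup_def subgroup.subset)
  then have "{g \<in> carrier G. g <# (a <# \<Gamma> i) = a <# \<Gamma> i} = \<Gamma> i"
    using l_coset_fix_iff_normal[OF nor a(1)] unfolding set_eq_iff mem_Collect_eq by (meson subsetD)
  then have "return_times G \<phi> ?W x = \<Gamma> i"
    using return_times_cylinder[OF x, of i] by (simp only: a(2))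
  then show "\<exists>W. openin X W \<and> closedin X W \<and> x \<in> W \<and> W \<subseteq> V \<and>
      syndetic_subgroup G (return_times G \<phi> W x) \<and> return_times G \<phi> W x \<lhd> G"
    using i clopen_cylinder[OF x, of i] x syn nor by (intro exI[of _ ?W]) simp
qed

end

lemma strongly_regularly_recurrent_imp_regularly_recurrent:
  assumes "strongly_regularly_recurrent_point G X \<phi> x"
  shows "regularly_recurrent_point G X \<phi> x"
  unfolding regularly_recurrent_point_def
proof (intro conjI allI impI)
  show "x \<in> topspace X" using assms by (simp add: strongly_regularly_recurrent_point_def)
  fix V assume "openin X V \<and> x \<in> V"
  then obtain W where "W \<subseteq> V" "syndetic_subgroup G (return_times G \<phi> W x)"
    using assms unfolding strongly_regularly_recurrent_point_def by meson
  moreover have "return_times G \<phi> W x \<subseteq> return_times G \<phi> V x"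
    using \<open>W \<subseteq> V\<close> by (auto simp: return_times_def)
  ultimately show "\<exists>H. syndetic_subgroup G H \<and> H \<subseteq> return_times G \<phi> V x" by blast
qed

section \<open>Construction of the almost 1-1 factor\<close>

lemma nested_clopen_return_sets:
  assumes x: "x \<in> topspace X"
    and base: "\<And>V. openin X V \<Longrightarrow> x \<in> V \<Longrightarrow> \<exists>W. openin X W \<and> closedin X W \<and> x \<in> W \<and> W \<subseteq> V \<and> Q W"
  obtains C :: "nat \<Rightarrow> 'x set"
  where "\<And>i. openin X (C i)" "\<And>i. closedin X (C i)" "\<And>i. Q (C i)"
    "\<And>i. C (Suc i) \<subseteq> C i" "(\<Inter>i. C i) = {x}"
proof -
  obtain M d where "Metric_space M d" and XM: "X = Metric_space.mtopology M d"
    using metrizable_X by (auto simp: metrizable_space_def)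
  interpret Metric_space M d by fact
  have xM: "x \<in> M" using x by (simp add: XM)
  have "\<exists>C. \<forall>n. (openin X (C n) \<and> closedin X (C n) \<and> x \<in> C n \<and> Q (C n) \<and>
      C n \<subseteq> mball x (inverse (Suc n))) \<and> C (Suc n) \<subseteq> C n"
  proof (rule dependent_nat_choice)
    show "\<exists>W. openin X W \<and> closedin X W \<and> x \<in> W \<and> Q W \<and> W \<subseteq> mball x (inverse (Suc 0))"
      using base[of "mball x (inverse (Suc 0))"] xM by (auto simp: XM)
    fix W n
    assume W: "openin X W \<and> closedin X W \<and> x \<in> W \<and> Q W \<and> W \<subseteq> mball x (inverse (Suc n))"
    \<comment> \<open>Applying \<open>base\<close> inside both the previous set and the next smaller
      ball yields nesting and shrinking at once.\<close>
    then have "openin X (W \<inter> mball x (inverse (Suc (Suc n))))" by (auto simp: XM)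
    then show "\<exists>W'. (openin X W' \<and> closedin X W' \<and> x \<in> W' \<and> Q W' \<and>
        W' \<subseteq> mball x (inverse (Suc (Suc n)))) \<and> W' \<subseteq> W"
      using base[of "W \<inter> mball x (inverse (Suc (Suc n)))"] W xM by auto
  qed
  then obtain C where C: "\<And>n. openin X (C n)" "\<And>n. closedin X (C n)" "\<And>n. x \<in> C n" "\<And>n. Q (C n)"
    "\<And>n. C n \<subseteq> mball x (inverse (Suc n))" "\<And>n. C (Suc n) \<subseteq> C n" by blast
  have "z = x" if z: "\<And>n. z \<in> C n" for z
  proof (rule ccontr)
    assume "z \<noteq> x"
    have lt: "z \<in> M" "d x z < inverse (Suc n)" for n
      using z[of n] C(5)[of n] by auto
    then have "d x z > 0" using xM \<open>z \<noteq> x\<close> by simp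
    then obtain n where "inverse (real (Suc n)) < d x z" using reals_Archimedean by blast
    then show False using lt(2)[of n] by simp
  qed
  then have "(\<Inter>i. C i) = {x}" using C(3) by blast
  with C that show ?thesis by blast
qed

text \<open>The coordinates of \<open>\<pi>\<close> are the codes of a nested sequence of clopen
  return sets shrinking to \<open>x\<close>. The parameter \<open>Q\<close> lets one construction
  serve both cases: it is trivial for subodometers and normality for odometers.\<close>

lemma almost_one_to_one_subodometer_factor:
  assumes x: "x \<in> topspace X"
    and base: "\<And>V. openin X V \<Longrightarrow> x \<in> V \<Longrightarrow> \<exists>W. openin X W \<and> closedin X W \<and> x \<in> W \<and> W \<subseteq> V \<and>
      syndetic_subgroup G (return_times G \<phi> W x) \<and> Q (return_times G \<phi> W x)"
  obtains \<Gamma> \<pi> where "subodometer_sequence G \<Gamma>" "\<And>i. Q (\<Gamma> i)"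
    "almost_one_to_one_factor_map G X \<phi> (subodometer G \<Gamma>) (subodometer_action G \<Gamma>) \<pi>"
proof -
  obtain C :: "nat \<Rightarrow> 'x set" where C: "\<And>i. openin X (C i)" "\<And>i. closedin X (C i)"
    and Q: "\<And>i. syndetic_subgroup G (return_times G \<phi> (C i) x) \<and> Q (return_times G \<phi> (C i) x)"
    and dec: "\<And>i. C (Suc i) \<subseteq> C i" and Int: "(\<Inter>i. C i) = {x}"
    using nested_clopen_return_sets[OF x base] by metis
  define \<Gamma> where "\<Gamma> i = return_times G \<phi> (C i) x" for i
  define \<pi> where "\<pi> z i = coset_code (C i) z" for z i
  let ?Y = "subodometer G \<Gamma>"
  have xC: "x \<in> C i" for i using Int by blast
  have sub: "subgroup (\<Gamma> i) G" for i using Q by (simp add: \<Gamma>_def syndetic_subgroup_def)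
  note code = C xC sub[unfolded \<Gamma>_def]
  have \<Gamma>_dec: "\<Gamma> (Suc i) \<subseteq> \<Gamma> i" for i using dec by (auto simp: \<Gamma>_def return_times_def)
  have seq: "subodometer_sequence G \<Gamma>"
    using Q \<Gamma>_dec by (simp add: subodometer_sequence_def \<Gamma>_def)
  have proj: "coset_projection G (\<Gamma> i) (\<pi> z (Suc i)) = \<pi> z i" if z: "z \<in> topspace X" for z i
  proof -
    \<comment> \<open>As the sets decrease, \<open>g\<close> also lies in the code for
      \<open>C i\<close> and represents both cosets.\<close>
    obtain g where g: "g \<in> coset_code (C (Suc i)) z"
      using coset_code_nonempty[OF C(1) _ z] xC by blast
    then have "g \<in> coset_code (C i) z" "g \<in> carrier G" using dec by (auto simp: coset_code_def)
    then have "\<pi> z i = g <# \<Gamma> i" "\<pi> z (Suc i) = g <# \<Gamma> (Suc i)"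
      using g coset_code_eq[OF code z] by (simp_all add: \<pi>_def \<Gamma>_def)
    then show ?thesis
      using coset_projection_l_coset[OF is_group sub sub \<Gamma>_dec \<open>g \<in> carrier G\<close>] by simp
  qed
  have \<pi>_in: "\<pi> z \<in> topspace ?Y" if "z \<in> topspace X" for z
    using coset_code_in_lcosets[OF code that] proj[OF that]
    by (simp add: topspace_subodometer) (simp add: \<pi>_def \<Gamma>_def)
  have cont: "continuous_map X ?Y \<pi>"
    unfolding subodometer_def continuous_map_in_subtopology continuous_map_componentwise_UNIV
    using continuous_map_coset_code[OF code] proj by (auto simp: \<pi>_def[abs_def] \<Gamma>_def)
  have surj: "\<pi> ` topspace X = topspace ?Y"
  proof
    show "\<pi> ` topspace X \<subseteq> topspace ?Y" using \<pi>_in by blast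
    show "topspace ?Y \<subseteq> \<pi> ` topspace X"
    proof
      fix y assume y: "y \<in> topspace ?Y"
      \<comment> \<open>A preimage of \<open>y\<close> is a common point of these nested nonempty
        closed sets, which exists by compactness.\<close>
      define A where "A i = {z \<in> topspace X. \<pi> z i = y i}" for i
      have A: "closedin X (A i) \<and> A i \<noteq> {}" for i
      proof -
        obtain g where g: "g \<in> carrier G" "y i = g <# \<Gamma> i"
          using y unfolding topspace_subodometer mem_lcosets_iff by blast
        have "A i = {z \<in> topspace X. g \<in> coset_code (C i) z}"
          using coset_code_fibre[OF code g(1), of i] by (simp add: A_def \<pi>_def g \<Gamma>_def)
        moreover have "\<phi> g x \<in> A i"
          using coset_code_orbit[OF code g(1), of i] g x by (simp add: A_def \<pi>_def \<Gamma>_def)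
        ultimately show ?thesis using closedin_translate[OF code g(1)] by auto
      qed
      have "A (Suc i) \<subseteq> A i" for i
      proof
        fix z assume "z \<in> A (Suc i)"
        then have z: "z \<in> topspace X" "\<pi> z (Suc i) = y (Suc i)" by (auto simp: A_def)
        have "\<pi> z i = coset_projection G (\<Gamma> i) (y (Suc i))" using proj[OF z(1)] z(2) by metis
        then show "z \<in> A i" using y z(1) by (simp add: A_def topspace_subodometer)
      qed
      then have "(\<Inter>i. A i) \<noteq> {}"
        using compact_space_imp_nest[OF compact_X, of A] A by (simp add: decseq_Suc_iff)
      then obtain z where "z \<in> topspace X" "\<pi> z = y" by (auto simp: A_def)
      then show "y \<in> \<pi> ` topspace X" by blast
    qed
  qed
  have "\<pi> (\<phi> g z) = subodometer_action G \<Gamma> g (\<pi> z)" if "g \<in> carrier G" "z \<in> topspace X" for g z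
  proof
    fix i
    have "\<pi> (\<phi> g z) i = g <# \<pi> z i" using coset_code_act[OF that] by (simp add: \<pi>_def)
    then show "\<pi> (\<phi> g z) i = subodometer_action G \<Gamma> g (\<pi> z) i"
      using \<pi>_in that by (simp add: subodometer_action_apply)
  qed
  then have factor: "factor_map G X \<phi> ?Y (subodometer_action G \<Gamma>) \<pi>"
    using cont surj by (simp add: factor_map_def)
  \<comment> \<open>If \<open>z\<close> has the same image, then \<open>\<phi> (inv g) z\<close> has
    the same codes as \<open>x\<close>. These contain \<open>\<one>\<close>, so the point lies in
    every \<open>C i\<close> and equals \<open>x\<close>.\<close>
  have "\<pi> (\<phi> g x) \<in> injectivity_points X ?Y \<pi>" if g: "g \<in> carrier G" for g
  proof -
    have "z = \<phi> g x" if z: "z \<in> topspace X" "\<pi> z = \<pi> (\<phi> g x)" for z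
    proof -
      have "\<phi> (inv g) z \<in> C i" for i
      proof -
        have "coset_code (C i) z = coset_code (C i) (\<phi> g x)"
          using fun_cong[OF z(2), of i] by (simp add: \<pi>_def)
        then have "coset_code (C i) (\<phi> (inv g) z) = coset_code (C i) x"
          using coset_code_act_cancel[of g "\<phi> (inv g) z" x "C i"] g x z(1) by simp
        then show ?thesis
          using one_in_coset_code[of _ "C i"] x xC g z(1) by (metis act_in inv_closed)
      qed
      then have "\<phi> (inv g) z = x" using Int by blast
      then show ?thesis using act_inv(2)[OF g z(1)] by simp
    qed
    then have "\<exists>!z. z \<in> topspace X \<and> \<pi> z = \<pi> (\<phi> g x)"
      using g x by (intro ex1I[of _ "\<phi> g x"]) auto
    then show ?thesis using g x \<pi>_in unfolding injectivity_points_def by simp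
  qed
  then have orbit: "\<pi> ` orbit G \<phi> x \<subseteq> injectivity_points X ?Y \<pi>"
    by (auto simp: orbit_def)
  \<comment> \<open>The image of the dense orbit of \<open>x\<close> is dense and consists of
    injectivity points.\<close>
  have "topspace ?Y = \<pi> ` (X closure_of (orbit G \<phi> x))"
    using surj closure_of_orbit[OF x] by simp
  also have "\<dots> \<subseteq> ?Y closure_of (\<pi> ` orbit G \<phi> x)"
    by (rule continuous_map_image_closure_subset[OF cont])
  also have "\<dots> \<subseteq> ?Y closure_of (injectivity_points X ?Y \<pi>)"
    by (rule closure_of_mono[OF orbit])
  finally have "?Y closure_of (injectivity_points X ?Y \<pi>) = topspace ?Y"
    by (simp add: closure_of_subset_topspace subset_antisym)
  moreover have "gdelta_in ?Y (injectivity_points X ?Y \<pi>)"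
    using gdelta_in_injectivity_points[OF compact_X metrizable_X Hausdorff_space_subodometer cont surj] .
  ultimately have "almost_one_to_one_factor_map G X \<phi> ?Y (subodometer_action G \<Gamma>) \<pi>"
    using factor unfolding almost_one_to_one_factor_map_def by blast
  with seq Q that show ?thesis by (simp add: \<Gamma>_def)
qed

section \<open>Recurrent points and the two equivalences\<close>

lemma almost_one_to_one_imp_injectivity_point:
  assumes "subodometer_sequence G \<Gamma>"
    and "almost_one_to_one_factor_map G X \<phi> (subodometer G \<Gamma>) (subodometer_action G \<Gamma>) \<pi>"
  obtains x where "x \<in> topspace X" "\<pi> x \<in> injectivity_points X (subodometer G \<Gamma>) \<pi>"
proof -
  obtain D where "Abstract_Topology.closure_of (subodometer G \<Gamma>) D = topspace (subodometer G \<Gamma>)"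
    "D \<subseteq> injectivity_points X (subodometer G \<Gamma>) \<pi>"
    using assms(2) by (auto simp: almost_one_to_one_factor_map_def)
  then have "injectivity_points X (subodometer G \<Gamma>) \<pi> \<noteq> {}"
    using topspace_subodometer_nonempty[OF assms(1)] closure_of_empty subset_empty by metis
  then show ?thesis using that by (auto simp: injectivity_points_def)
qed

text \<open>Density supplies one injectivity point \<open>\<pi> x0\<close>, and comparison with it
  shows that every regularly recurrent point lies over an injectivity point.\<close>

lemma regularly_recurrent_points_eq:
  assumes \<Gamma>: "subodometer_sequence G \<Gamma>"
    and \<pi>: "almost_one_to_one_factor_map G X \<phi> (subodometer G \<Gamma>) (subodometer_action G \<Gamma>) \<pi>"
  shows "{x. regularly_recurrent_point G X \<phi> x} =
         {x \<in> topspace X. \<pi> x \<in> injectivity_points X (subodometer G \<Gamma>) \<pi>}"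
proof -
  have factor: "factor_map G X \<phi> (subodometer G \<Gamma>) (subodometer_action G \<Gamma>) \<pi>"
    using \<pi> by (simp add: almost_one_to_one_factor_map_def)
  obtain x0 where "\<pi> x0 \<in> injectivity_points X (subodometer G \<Gamma>) \<pi>"
    using almost_one_to_one_imp_injectivity_point[OF \<Gamma> \<pi>] .
  then show ?thesis
    using regularly_recurrent_imp_injectivity_point[OF _ factor Hausdorff_space_subodometer]
      injectivity_point_imp_regularly_recurrent[OF factor \<Gamma>]
    by (auto simp: regularly_recurrent_point_def)
qed

text \<open>The implications close a cycle: strongly regularly recurrent, regularly recurrent, over
  an injectivity point, and back by normality of the \<open>\<Gamma> i\<close>.\<close>

lemma strongly_regularly_recurrent_points_eq:
  assumes \<Gamma>: "odometer_sequence G \<Gamma>"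
    and \<pi>: "almost_one_to_one_factor_map G X \<phi> (subodometer G \<Gamma>) (subodometer_action G \<Gamma>) \<pi>"
  shows "{x. strongly_regularly_recurrent_point G X \<phi> x} =
         {x \<in> topspace X. \<pi> x \<in> injectivity_points X (subodometer G \<Gamma>) \<pi>}"
proof -
  have "factor_map G X \<phi> (subodometer G \<Gamma>) (subodometer_action G \<Gamma>) \<pi>"
    using \<pi> by (simp add: almost_one_to_one_factor_map_def)
  moreover have "subodometer_sequence G \<Gamma>"
    using \<Gamma> by (simp add: odometer_sequence_def)
  ultimately show ?thesis
    using regularly_recurrent_points_eq[OF _ \<pi>] strongly_regularly_recurrent_imp_regularly_recurrent
      injectivity_point_imp_strongly_regularly_recurrent[OF _ \<Gamma>]
    by blast
qed

lemma regularly_recurrent_system_iff: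
  "regularly_recurrent_system G X \<phi> \<longleftrightarrow>
   (\<exists>\<Gamma> \<pi>. subodometer_sequence G \<Gamma> \<and>
      almost_one_to_one_factor_map G X \<phi> (subodometer G \<Gamma>) (subodometer_action G \<Gamma>) \<pi>)"
  (is "?L \<longleftrightarrow> ?R")
proof
  assume ?L
  then obtain x where rr: "regularly_recurrent_point G X \<phi> x"
    by (auto simp: regularly_recurrent_system_def)
  then have x: "x \<in> topspace X" by (simp add: regularly_recurrent_point_def)
  show ?R
  proof (rule almost_one_to_one_subodometer_factor[OF x, of "\<lambda>_. True"])
    fix V assume "openin X V" "x \<in> V"
    then show "\<exists>W. openin X W \<and> closedin X W \<and> x \<in> W \<and> W \<subseteq> V \<and>
        syndetic_subgroup G (return_times G \<phi> W x) \<and> True"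
      using regularly_recurrent_clopen[OF rr] by metis
  qed blast
next
  assume ?R
  then obtain \<Gamma> \<pi> where \<Gamma>: "subodometer_sequence G \<Gamma>"
    and \<pi>: "almost_one_to_one_factor_map G X \<phi> (subodometer G \<Gamma>) (subodometer_action G \<Gamma>) \<pi>"
    by blast
  obtain x where "x \<in> topspace X" "\<pi> x \<in> injectivity_points X (subodometer G \<Gamma>) \<pi>"
    using almost_one_to_one_imp_injectivity_point[OF \<Gamma> \<pi>] .
  then show ?L
    using regularly_recurrent_points_eq[OF \<Gamma> \<pi>] closure_of_orbit
    by (auto simp: regularly_recurrent_system_def)
qed

lemma strongly_regularly_recurrent_system_iff:
  "strongly_regularly_recurrent_system G X \<phi> \<longleftrightarrow>
   (\<exists>\<Gamma> \<pi>. odometer_sequence G \<Gamma> \<and>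
      almost_one_to_one_factor_map G X \<phi> (subodometer G \<Gamma>) (subodometer_action G \<Gamma>) \<pi>)"
  (is "?L \<longleftrightarrow> ?R")
proof
  assume ?L
  then obtain x where rr: "strongly_regularly_recurrent_point G X \<phi> x"
    by (auto simp: strongly_regularly_recurrent_system_def)
  then have x: "x \<in> topspace X" by (simp add: strongly_regularly_recurrent_point_def)
  show ?R
  proof (rule almost_one_to_one_subodometer_factor[OF x, of "\<lambda>H. H \<lhd> G"])
    fix V assume "openin X V" "x \<in> V"
    then show "\<exists>W. openin X W \<and> closedin X W \<and> x \<in> W \<and> W \<subseteq> V \<and>
        syndetic_subgroup G (return_times G \<phi> W x) \<and> return_times G \<phi> W x \<lhd> G"
      using rr by (simp add: strongly_regularly_recurrent_point_def)
  qed (auto simp: odometer_sequence_def)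
next
  assume ?R
  then obtain \<Gamma> \<pi> where \<Gamma>: "odometer_sequence G \<Gamma>"
    and \<pi>: "almost_one_to_one_factor_map G X \<phi> (subodometer G \<Gamma>) (subodometer_action G \<Gamma>) \<pi>"
    by blast
  obtain x where "x \<in> topspace X" "\<pi> x \<in> injectivity_points X (subodometer G \<Gamma>) \<pi>"
    using almost_one_to_one_imp_injectivity_point[OF _ \<pi>] \<Gamma> by (auto simp: odometer_sequence_def)
  then show ?L
    using strongly_regularly_recurrent_points_eq[OF \<Gamma> \<pi>] closure_of_orbit
    by (auto simp: strongly_regularly_recurrent_system_def)
qed

end

theorem theorem2:
  fixes G :: "('g, 'm) monoid_scheme"
    and X :: "'x topology"
    and \<phi> :: "'g \<Rightarrow> 'x \<Rightarrow> 'x"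
  assumes "finitely_generated_group G"
    and "minimal_system G X \<phi>"
  shows
    "((\<exists>\<Gamma> \<pi>. subodometer_sequence G \<Gamma> \<and>
        almost_one_to_one_factor_map G X \<phi> (subodometer G \<Gamma>) (subodometer_action G \<Gamma>) \<pi>)
      \<longleftrightarrow> regularly_recurrent_system G X \<phi>) \<and>
     (\<forall>\<Gamma> \<pi>. subodometer_sequence G \<Gamma> \<and>
        almost_one_to_one_factor_map G X \<phi> (subodometer G \<Gamma>) (subodometer_action G \<Gamma>) \<pi>
      \<longrightarrow> {x. regularly_recurrent_point G X \<phi> x} =
          {x \<in> topspace X. \<pi> x \<in> injectivity_points X (subodometer G \<Gamma>) \<pi>}) \<and>
     ((\<exists>\<Gamma> \<pi>. odometer_sequence G \<Gamma> \<and>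
        almost_one_to_one_factor_map G X \<phi> (subodometer G \<Gamma>) (subodometer_action G \<Gamma>) \<pi>)
      \<longleftrightarrow> strongly_regularly_recurrent_system G X \<phi>) \<and>
     (\<forall>\<Gamma> \<pi>. odometer_sequence G \<Gamma> \<and>
        almost_one_to_one_factor_map G X \<phi> (subodometer G \<Gamma>) (subodometer_action G \<Gamma>) \<pi>
      \<longrightarrow> {x. strongly_regularly_recurrent_point G X \<phi> x} =
          {x \<in> topspace X. \<pi> x \<in> injectivity_points X (subodometer G \<Gamma>) \<pi>})"
proof -
  interpret minimal_action G X \<phi>
    using assms by (simp add: minimal_action_def minimal_action_axioms_def finitely_generated_group_def)
  show ?thesis
    using regularly_recurrent_system_iff strongly_regularly_recurrent_system_iff
      regularly_recurrent_points_eq strongly_regularly_recurrent_points_eq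
    by simp
qed

end
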